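(* The bilinear form $\langle\cdot,\cdot\rangle$, defined on pairs of diagrams and extended by linearity, is well-defined on $R_n$; that is, it respects all Type I and Type II relations.
   Context: A diagram is a crossingless matching of the points $1,\ldots,2n$ on a horizontal line (arcs drawn below the line), each arc carrying at most one dot. $R_n$ is the $\mathbb{Z}$-module spanned by diagrams modulo the following relations, for $a<b<c<d$ and diagrams identical away from arcs ending at $a,b,c,d$ (a bar marks a dotted arc). Type I: $[\overline{ab},cd]+[ab,\overline{cd}]=[\overline{ad},bc]+[ad,\overline{bc}]$. Type II: $[\overline{ab},\overline{cd}]=[\overline{ad},\overline{bc}]$. Pairing of diagrams $a,b$: rotate $b$ by 180 degrees, replace each of its dots by an X, and glue its endpoints to those of $a$ (so endpoint $j$ of $a$ is glued to endpoint $2n+1-j$ of $b$). The result is a collection of circles decorated with dots and X's; marks may slide along a circle but not past one another. $\langle a,b\rangle\in\mathbb{Z}$ is the product over the circles of the following values: a circle with no marks has value $2$; a circle with the same number (at least one) of dots and X's, arranged alternately, has value $1$; any other circle has value $0$. *)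

theory Defs
  imports
    "HOL-Algebra.Free_Abelian_Groups"
    "HOL-Algebra.Generated_Groups"
    "HOL-Combinatorics.Cycles"
begin

text \<open>The triple \<open>(i, j, m)\<close> is the arc from \<open>i\<close> to \<open>j\<close>; it carries a dot iff \<open>m\<close> holds.\<close>

type_synonym arc = "nat \<times> nat \<times> bool"
type_synonym diagram = "arc set"

definition diagrams :: "nat \<Rightarrow> diagram set" where
  "diagrams n = {D.
     (\<forall>(i, j, m) \<in> D. 1 \<le> i \<and> i < j \<and> j \<le> 2 * n) \<and>
     (\<forall>p \<in> {1..2 * n}. \<exists>!e. e \<in> D \<and> (p = fst e \<or> p = fst (snd e))) \<and>
     (\<forall>(i, j, m) \<in> D. \<forall>(k, l, m') \<in> D. \<not> (i < k \<and> k < j \<and> j < l))}"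

subsection \<open>The module\<close>

text \<open>In both relations \<open>E\<close> is the common part of the diagrams. It cannot have arcs ending at
  \<open>a, b, c, d\<close>, since otherwise the unions below would not all be matchings.\<close>

inductive type_I :: "nat \<Rightarrow> (diagram \<Rightarrow>\<^sub>0 int) \<Rightarrow> (diagram \<Rightarrow>\<^sub>0 int) \<Rightarrow> bool" for n where
  "type_I n
     (frag_of ({(a, b, True), (c, d, False)} \<union> E) + frag_of ({(a, b, False), (c, d, True)} \<union> E))
     (frag_of ({(a, d, True), (b, c, False)} \<union> E) + frag_of ({(a, d, False), (b, c, True)} \<union> E))"
  if "a < b" "b < c" "c < d"
    "{(a, b, True), (c, d, False)} \<union> E \<in> diagrams n"
    "{(a, b, False), (c, d, True)} \<union> E \<in> diagrams n"
    "{(a, d, True), (b, c, False)} \<union> E \<in> diagrams n"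
    "{(a, d, False), (b, c, True)} \<union> E \<in> diagrams n"

inductive type_II :: "nat \<Rightarrow> (diagram \<Rightarrow>\<^sub>0 int) \<Rightarrow> (diagram \<Rightarrow>\<^sub>0 int) \<Rightarrow> bool" for n where
  "type_II n
     (frag_of ({(a, b, True), (c, d, True)} \<union> E))
     (frag_of ({(a, d, True), (b, c, True)} \<union> E))"
  if "a < b" "b < c" "c < d"
    "{(a, b, True), (c, d, True)} \<union> E \<in> diagrams n"
    "{(a, d, True), (b, c, True)} \<union> E \<in> diagrams n"

definition relation_subgroup :: "nat \<Rightarrow> (diagram \<Rightarrow>\<^sub>0 int) set" where
  "relation_subgroup n =
     generate (free_Abelian_group (diagrams n)) {l - r |l r. type_I n l r \<or> type_II n l r}"

definition R :: "nat \<Rightarrow> (diagram \<Rightarrow>\<^sub>0 int) set monoid" where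
  "R n = free_Abelian_group (diagrams n) Mod relation_subgroup n"

definition coset_of :: "nat \<Rightarrow> (diagram \<Rightarrow>\<^sub>0 int) \<Rightarrow> (diagram \<Rightarrow>\<^sub>0 int) set" where
  "coset_of n x = relation_subgroup n #>\<^bsub>free_Abelian_group (diagrams n)\<^esub> x"

subsection \<open>The pairing of diagrams\<close>

text \<open>After rotation, the point \<open>p\<close> of \<^term>\<open>rotate_diagram n D\<close> is the one glued to the
  point \<open>p\<close> of the other diagram.\<close>

definition rotate_diagram :: "nat \<Rightarrow> diagram \<Rightarrow> diagram" where
  "rotate_diagram n D = (\<lambda>(i, j, m). (2 * n + 1 - j, 2 * n + 1 - i, m)) ` D"

definition joins :: "diagram \<Rightarrow> (nat \<times> nat) set" where
  "joins D = {(p, q). \<exists>m. (p, q, m) \<in> D \<or> (q, p, m) \<in> D}"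

text \<open>Points that are not endpoints are fixed, which makes \<open>partner D\<close> a permutation.\<close>

definition partner :: "diagram \<Rightarrow> nat \<Rightarrow> nat" where
  "partner D p = (if p \<in> Domain (joins D) then THE q. (p, q) \<in> joins D else p)"

definition marked :: "diagram \<Rightarrow> nat \<Rightarrow> bool" where
  "marked D p \<longleftrightarrow> (\<exists>q. (p, q, True) \<in> D \<or> (q, p, True) \<in> D)"

definition circles :: "nat \<Rightarrow> diagram \<Rightarrow> diagram \<Rightarrow> nat set set" where
  "circles n a b = {1..2 * n} // (joins a \<union> joins (rotate_diagram n b))\<^sup>*"

datatype mark = Dot | Cross

text \<open>The marks met when travelling once around the circle through \<open>p\<close>, leaving \<open>p\<close> along its
  arc in \<open>a\<close>; arcs of \<open>a\<close> and of the rotated \<open>b\<close> are traversed in turn. The list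
  \<^term>\<open>support f p\<close> consists of \<open>p, f p, f (f p), \<dots>\<close> up to the first return to \<open>p\<close>.\<close>

definition circle_marks :: "nat \<Rightarrow> diagram \<Rightarrow> diagram \<Rightarrow> nat \<Rightarrow> mark list" where
  "circle_marks n a b p =
     concat (map
       (\<lambda>q. (if marked a q then [Dot] else []) @
            (if marked (rotate_diagram n b) (partner a q) then [Cross] else []))
       (support (partner (rotate_diagram n b) \<circ> partner a) p))"

text \<open>Alternation is cyclic: the last mark is followed by the first.\<close>

definition alternating :: "mark list \<Rightarrow> bool" where
  "alternating ms \<longleftrightarrow> (\<forall>i < length ms. ms ! i \<noteq> ms ! (Suc i mod length ms))"

definition circle_value :: "mark list \<Rightarrow> int" where
  "circle_value ms =
     (if ms = [] then 2
      else if count_list ms Dot = count_list ms Cross \<and> alternating ms then 1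
      else 0)"

text \<open>Another starting point on the circle \<open>C\<close> rotates or reverses the list of marks, which does
  not affect its value; \<^term>\<open>Min C\<close> is just a definite choice.\<close>

definition pairing :: "nat \<Rightarrow> diagram \<Rightarrow> diagram \<Rightarrow> int" where
  "pairing n a b = (\<Prod>C \<in> circles n a b. circle_value (circle_marks n a b (Min C)))"

definition form :: "nat \<Rightarrow> (diagram \<Rightarrow>\<^sub>0 int) \<Rightarrow> (diagram \<Rightarrow>\<^sub>0 int) \<Rightarrow> int" where
  "form n x y =
     (\<Sum>a \<in> Poly_Mapping.keys x. \<Sum>b \<in> Poly_Mapping.keys y.
        Poly_Mapping.lookup x a * Poly_Mapping.lookup y b * pairing n a b)"

definition bilinear_form :: "'a monoid \<Rightarrow> ('a \<Rightarrow> 'a \<Rightarrow> int) \<Rightarrow> bool" where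
  "bilinear_form G B \<longleftrightarrow>
     (\<forall>u \<in> carrier G. B u \<in> hom G integer_group \<and> (\<lambda>v. B v u) \<in> hom G integer_group)"

end

theory Submission
  imports Defs
begin

text \<open>The value of a circle is the trace of the product of its marks, where a dot is the matrix unit
  \<open>E\<^sub>1\<^sub>2\<close> and a cross is \<open>E\<^sub>2\<^sub>1\<close>. Expanding all traces writes the pairing of \<open>a\<close> and \<open>b\<close> as a
  sum over states of the \<open>2n\<close> points. Arcs join points of opposite parity, so each circle can be
  oriented such that the arcs of \<open>a\<close> lead from odd to even points and those of the rotated \<open>b\<close> back;
  hence the summand is a product of a weight depending on \<open>a\<close> and the state only and of one depending
  on \<open>b\<close> and the state only. The Type I and Type II relations hold for these weights state by state.\<close>

subsection \<open>Diagrams as involutions\<close>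

text \<open>Removing \<open>x\<close> together with \<open>g x\<close> leaves a smaller set on which
  \<open>g\<close> is still an involution without fixed points.\<close>

lemma even_card_involution:
  assumes "finite A" "\<And>x. x \<in> A \<Longrightarrow> g x \<in> A \<and> g x \<noteq> x \<and> g (g x) = x"
  shows "even (card A)"
  using assms
proof (induction A rule: finite_psubset_induct)
  case (psubset A)
  show ?case
  proof (cases "A = {}")
    case False
    then obtain x where x: "x \<in> A" by blast
    let ?B = "A - {x, g x}"
    have "even (card ?B)"
    proof (rule psubset.IH)
      show "?B \<subset> A" using x by blast
      show "g y \<in> ?B \<and> g y \<noteq> y \<and> g (g y) = y" if "y \<in> ?B" for y
        using that psubset.prems x by (metis Diff_iff insert_iff singletonD)
    qed
    moreover have "card A = card ?B + 2"
    proof -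
      have "card {x, g x} = 2" "{x, g x} \<subseteq> A"
        using psubset.prems[OF x] x by auto
      then show ?thesis
        using psubset.hyps card_Diff_subset[of "{x, g x}" A] card_mono[of A "{x, g x}"] by simp
    qed
    ultimately show ?thesis by simp
  qed simp
qed

lemma diagram_bounds:
  assumes "D \<in> diagrams n" "(i, j, m) \<in> D"
  shows "1 \<le> i" "i < j" "j \<le> 2 * n" "i \<in> {1..2 * n}" "j \<in> {1..2 * n}"
proof -
  have "\<forall>(i, j, m) \<in> D. 1 \<le> i \<and> i < j \<and> j \<le> 2 * n"
    using assms(1) unfolding diagrams_def mem_Collect_eq by (elim conjE)
  then show "1 \<le> i" "i < j" "j \<le> 2 * n" "i \<in> {1..2 * n}" "j \<in> {1..2 * n}"
    using assms(2) by auto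
qed

lemma diagram_arc_unique:
  assumes "D \<in> diagrams n" "e \<in> D" "e' \<in> D"
    and "p = fst e \<or> p = fst (snd e)" "p = fst e' \<or> p = fst (snd e')"
  shows "e = e'"
proof -
  have "p \<in> {1..2 * n}"
    using assms(4) diagram_bounds[OF assms(1), of "fst e" "fst (snd e)" "snd (snd e)"] assms(2)
    by auto
  then have "\<exists>!e. e \<in> D \<and> (p = fst e \<or> p = fst (snd e))"
    using assms(1) unfolding diagrams_def mem_Collect_eq by blast
  then show ?thesis using assms by blast
qed

lemma diagram_point_arc:
  assumes "D \<in> diagrams n" "p \<in> {1..2 * n}"
  obtains i j m where "(i, j, m) \<in> D" "p = i \<or> p = j"
proof -
  have "\<exists>!e. e \<in> D \<and> (p = fst e \<or> p = fst (snd e))"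
    using assms unfolding diagrams_def by blast
  then show ?thesis using that by (metis prod.collapse)
qed

lemma diagram_noncrossing:
  assumes "D \<in> diagrams n" "(i, j, m) \<in> D" "(k, l, m') \<in> D"
  shows "\<not> (i < k \<and> k < j \<and> j < l)"
proof -
  have "\<forall>(i, j, m) \<in> D. \<forall>(k, l, m') \<in> D. \<not> (i < k \<and> k < j \<and> j < l)"
    using assms(1) unfolding diagrams_def mem_Collect_eq by (elim conjE)
  then show ?thesis using assms(2,3) by auto
qed

lemma joins_arc:
  assumes "D \<in> diagrams n" "(i, j, m) \<in> D"
  shows "(i, q) \<in> joins D \<longleftrightarrow> q = j" "(j, q) \<in> joins D \<longleftrightarrow> q = i"
proof -
  have *: "k = i \<and> l = j" if "(k, l, m') \<in> D" "i = k \<or> i = l \<or> j = k \<or> j = l" for k l m'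
    using diagram_arc_unique[OF assms(1) that(1) assms(2)] that(2) by auto
  have "i \<noteq> j" using diagram_bounds[OF assms] by auto
  then show "(i, q) \<in> joins D \<longleftrightarrow> q = j" "(j, q) \<in> joins D \<longleftrightarrow> q = i"
    using assms(2) * unfolding joins_def by blast+
qed

lemma partner_arc:
  assumes "D \<in> diagrams n" "(i, j, m) \<in> D"
  shows "partner D i = j" "partner D j = i"
  using joins_arc[OF assms] unfolding partner_def by (auto simp: Domain_iff)

lemma marked_arc:
  assumes "D \<in> diagrams n" "(i, j, m) \<in> D"
  shows "marked D i \<longleftrightarrow> m" "marked D j \<longleftrightarrow> m"
proof -
  have *: "m' = m" if "(k, l, m') \<in> D" "i = k \<or> i = l \<or> j = k \<or> j = l" for k l m'
    using diagram_arc_unique[OF assms(1) that(1) assms(2)] that(2) by auto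
  show "marked D i \<longleftrightarrow> m" "marked D j \<longleftrightarrow> m"
    using assms(2) * unfolding marked_def by (metis (full_types))+
qed

lemma partner_in:
  assumes "D \<in> diagrams n" "p \<in> {1..2 * n}"
  shows "partner D p \<in> {1..2 * n}"
  using assms partner_arc diagram_bounds diagram_point_arc by metis

lemma partner_neq:
  assumes "D \<in> diagrams n" "p \<in> {1..2 * n}"
  shows "partner D p \<noteq> p"
  using assms partner_arc diagram_bounds(2) diagram_point_arc by (metis less_irrefl)

lemma partner_outside:
  assumes "D \<in> diagrams n" "p \<notin> {1..2 * n}"
  shows "partner D p = p"
proof -
  have "p \<notin> Domain (joins D)"
    using assms(2) diagram_bounds(4,5)[OF assms(1)] unfolding joins_def by blast
  then show ?thesis by (simp add: partner_def)
qed

lemma partner_partner: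
  assumes "D \<in> diagrams n"
  shows "partner D (partner D p) = p"
  using assms partner_arc diagram_point_arc partner_outside by metis

lemma marked_partner:
  assumes "D \<in> diagrams n" "p \<in> {1..2 * n}"
  shows "marked D (partner D p) \<longleftrightarrow> marked D p"
  using assms partner_arc marked_arc diagram_point_arc by metis

text \<open>Turns the relation that generates the circles into the graph of an involution on the
  points.\<close>

lemma joins_iff:
  assumes "D \<in> diagrams n"
  shows "(p, q) \<in> joins D \<longleftrightarrow> p \<in> {1..2 * n} \<and> q = partner D p"
proof
  assume "(p, q) \<in> joins D"
  then obtain m where "(p, q, m) \<in> D \<or> (q, p, m) \<in> D"
    unfolding joins_def by blast
  then show "p \<in> {1..2 * n} \<and> q = partner D p"
    using diagram_bounds(4,5)[OF assms] partner_arc[OF assms] by metis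
next
  assume "p \<in> {1..2 * n} \<and> q = partner D p"
  moreover from this obtain i j m where ij: "(i, j, m) \<in> D" "p = i \<or> p = j"
    using diagram_point_arc[OF assms] by blast
  ultimately show "(p, q) \<in> joins D"
    using joins_arc[OF assms ij(1)] partner_arc[OF assms ij(1)] by auto
qed

lemma partner_permutes:
  assumes "D \<in> diagrams n"
  shows "partner D permutes {1..2 * n}"
  unfolding permutes_def
proof (intro conjI allI impI)
  show "\<exists>!x. partner D x = y" for y
    by (rule ex1I[of _ "partner D y"]) (use partner_partner[OF assms] in auto)
qed (use partner_outside[OF assms] in blast)

text \<open>The points strictly below an arc are matched among themselves, so their number is even.\<close>

lemma diagram_arc_parity:
  assumes D: "D \<in> diagrams n" and ij: "(i, j, m) \<in> D"
  shows "even j \<longleftrightarrow> odd i"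
proof -
  have "even (card {i<..<j})"
  proof (rule even_card_involution)
    fix x assume x: "x \<in> {i<..<j}"
    then have xN: "x \<in> {1..2 * n}" using diagram_bounds[OF D ij] by auto
    obtain k l m' where kl: "(k, l, m') \<in> D" "x = k \<or> x = l"
      using diagram_point_arc[OF D xN] by blast
    have "e = (i, j, m)" if "e \<in> D" "i = fst e \<or> i = fst (snd e) \<or> j = fst e \<or> j = fst (snd e)" for e
      using that diagram_arc_unique[OF D that(1) ij] by auto
    from this[OF kl(1)] have "k \<noteq> i" "l \<noteq> j" "k \<noteq> j" "l \<noteq> i" using kl x by auto
    moreover have "k < l" using diagram_bounds[OF D kl(1)] by blast
    \<comment> \<open>Noncrossing is applied in both orders: once to keep an arc starting inside
      from ending beyond \<open>j\<close>, once to keep an arc ending inside from starting before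
      \<open>i\<close>.\<close>
    ultimately have "k \<in> {i<..<j}" "l \<in> {i<..<j}"
      using diagram_noncrossing[OF D ij kl(1)] diagram_noncrossing[OF D kl(1) ij] kl(2) x by auto
    then have "partner D x \<in> {i<..<j}" using partner_arc[OF D kl(1)] kl(2) by auto
    then show "partner D x \<in> {i<..<j} \<and> partner D x \<noteq> x \<and> partner D (partner D x) = x"
      using partner_partner[OF D] partner_neq[OF D xN] by auto
  qed simp
  moreover obtain d where d: "j = Suc (i + d)"
    using diagram_bounds(2)[OF D ij] less_imp_Suc_add by blast
  ultimately have "even d" by simp
  then show ?thesis unfolding d by simp
qed

lemma partner_parity:
  assumes "D \<in> diagrams n" "p \<in> {1..2 * n}"
  shows "even (partner D p) \<longleftrightarrow> odd p"
proof -
  obtain i j m where ij: "(i, j, m) \<in> D" "p = i \<or> p = j"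
    using diagram_point_arc[OF assms] by metis
  then consider "p = i" "partner D p = j" | "p = j" "partner D p = i"
    using partner_arc[OF assms(1) ij(1)] by metis
  then show ?thesis
    by cases (use diagram_arc_parity[OF assms(1) ij(1)] in simp_all)
qed

section \<open>Rotation of diagrams\<close>

lemma rotate_diagram_arc_iff:
  assumes "D \<in> diagrams n"
  shows "(i, j, m) \<in> rotate_diagram n D \<longleftrightarrow>
    i \<le> 2 * n \<and> j \<le> 2 * n \<and> (2 * n + 1 - j, 2 * n + 1 - i, m) \<in> D"
proof
  assume "(i, j, m) \<in> rotate_diagram n D"
  then obtain k l where "(k, l, m) \<in> D" "i = 2 * n + 1 - l" "j = 2 * n + 1 - k"
    unfolding rotate_diagram_def by auto
  then show "i \<le> 2 * n \<and> j \<le> 2 * n \<and> (2 * n + 1 - j, 2 * n + 1 - i, m) \<in> D"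
    using diagram_bounds[OF assms, of k l m] by auto
next
  assume "i \<le> 2 * n \<and> j \<le> 2 * n \<and> (2 * n + 1 - j, 2 * n + 1 - i, m) \<in> D"
  then show "(i, j, m) \<in> rotate_diagram n D"
    unfolding rotate_diagram_def by (intro image_eqI[of _ _ "(2 * n + 1 - j, 2 * n + 1 - i, m)"]) auto
qed

lemma rotate_diagram_in:
  assumes D: "D \<in> diagrams n"
  shows "rotate_diagram n D \<in> diagrams n"
proof -
  let ?r = "\<lambda>p. 2 * n + 1 - p"
  note iff = rotate_diagram_arc_iff[OF D]
  have bounds: "1 \<le> i \<and> i < j \<and> j \<le> 2 * n" if "(i, j, m) \<in> rotate_diagram n D" for i j m
    using that diagram_bounds[OF D, of "?r j" "?r i" m] unfolding iff by auto
  have "\<exists>!e. e \<in> rotate_diagram n D \<and> (p = fst e \<or> p = fst (snd e))" if p: "p \<in> {1..2 * n}" for p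
  proof -
    have "?r p \<in> {1..2 * n}" using p by auto
    then obtain i j m where ij: "(i, j, m) \<in> D" "?r p = i \<or> ?r p = j"
      using diagram_point_arc[OF D] by blast
    show ?thesis
    proof (rule ex1I[of _ "(?r j, ?r i, m)"])
      have "p = ?r i \<or> p = ?r j" using ij(2) p by auto
      then show "(?r j, ?r i, m) \<in> rotate_diagram n D \<and>
        (p = fst (?r j, ?r i, m) \<or> p = fst (snd (?r j, ?r i, m)))"
        using ij diagram_bounds[OF D ij(1)] unfolding iff by auto
    next
      fix e assume e: "e \<in> rotate_diagram n D \<and> (p = fst e \<or> p = fst (snd e))"
      obtain k l m' where kl: "e = (k, l, m')" by (cases e)
      have "(?r l, ?r k, m') \<in> D" "k \<le> 2 * n" "l \<le> 2 * n" using e unfolding kl iff by auto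
      moreover have "(?r l, ?r k, m') = (i, j, m)"
        by (rule diagram_arc_unique[OF D calculation(1) ij(1), of "?r p"]) (use e kl ij(2) in auto)
      ultimately show "e = (?r j, ?r i, m)" using kl by auto
    qed
  qed
  moreover have "\<not> (i < k \<and> k < j \<and> j < l)"
    if "(i, j, m) \<in> rotate_diagram n D" "(k, l, m') \<in> rotate_diagram n D" for i j k l m m'
  proof
    assume "i < k \<and> k < j \<and> j < l"
    moreover have "l \<le> 2 * n" "(?r l, ?r k, m') \<in> D" "(?r j, ?r i, m) \<in> D"
      using that unfolding iff by blast+
    \<comment> \<open>Reflection reverses the order, so a crossing of the rotated arcs is a crossing
      of the original ones with their roles exchanged.\<close>
    moreover from calculation have "?r l < ?r j \<and> ?r j < ?r k \<and> ?r k < ?r i" by linarith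
    ultimately show False using diagram_noncrossing[OF D] by blast
  qed
  ultimately show ?thesis
    using bounds unfolding diagrams_def mem_Collect_eq by (intro conjI) fast+
qed

subsection \<open>Admissible states\<close>

text \<open>A state of the points is the set of those that are on. Along a circle the arcs of the two
  diagrams are traversed in opposite directions between odd and even points, so the same condition
  makes a dot the matrix unit \<open>E\<^sub>1\<^sub>2\<close> and a cross the matrix unit \<open>E\<^sub>2\<^sub>1\<close>.\<close>

definition admissible :: "diagram \<Rightarrow> nat set \<Rightarrow> bool" where
  "admissible D S \<longleftrightarrow> (\<forall>(i, j, m) \<in> D.
     if m then (i \<in> S \<longleftrightarrow> even i) \<and> (j \<in> S \<longleftrightarrow> even j) else (i \<in> S \<longleftrightarrow> j \<in> S))"

text \<open>A pointwise form of admissibility: circles are sets of points, so this version can be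
  split along them.\<close>

definition admissible_at :: "diagram \<Rightarrow> nat set \<Rightarrow> nat \<Rightarrow> bool" where
  "admissible_at D S p \<longleftrightarrow>
     (if marked D p then p \<in> S \<longleftrightarrow> even p else p \<in> S \<longleftrightarrow> partner D p \<in> S)"

lemma admissible_iff_at:
  assumes D: "D \<in> diagrams n"
  shows "admissible D S \<longleftrightarrow> (\<forall>p \<in> {1..2 * n}. admissible_at D S p)"
proof
  assume adm: "admissible D S"
  show "\<forall>p \<in> {1..2 * n}. admissible_at D S p"
  proof
    fix p assume "p \<in> {1..2 * n}"
    then obtain i j m where ij: "(i, j, m) \<in> D" "p = i \<or> p = j"
      using diagram_point_arc[OF D] by blast
    then show "admissible_at D S p"
      using adm partner_arc[OF D ij(1)] marked_arc[OF D ij(1)]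
      unfolding admissible_def admissible_at_def by fastforce
  qed
next
  assume at: "\<forall>p \<in> {1..2 * n}. admissible_at D S p"
  show "admissible D S"
    unfolding admissible_def
  proof (clarify)
    fix i j m assume ij: "(i, j, m) \<in> D"
    then show "if m then (i \<in> S \<longleftrightarrow> even i) \<and> (j \<in> S \<longleftrightarrow> even j) else (i \<in> S \<longleftrightarrow> j \<in> S)"
      using at diagram_bounds(4,5)[OF D ij] partner_arc[OF D ij] marked_arc[OF D ij]
      unfolding admissible_at_def by metis
  qed
qed

text \<open>The reflection exchanges even and odd points. Complementing the state compensates for
  this at dotted arcs, and the condition at undotted arcs is invariant under complement.\<close>

lemma admissible_rotate:
  assumes D: "D \<in> diagrams n"
  shows "admissible (rotate_diagram n D) S \<longleftrightarrow> admissible D {x. 2 * n + 1 - x \<notin> S}"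
proof -
  have "admissible (rotate_diagram n D) S \<longleftrightarrow> (\<forall>(i, j, m) \<in> D.
     if m then (2 * n + 1 - j \<in> S \<longleftrightarrow> even (2 * n + 1 - j)) \<and> (2 * n + 1 - i \<in> S \<longleftrightarrow> even (2 * n + 1 - i))
     else (2 * n + 1 - j \<in> S \<longleftrightarrow> 2 * n + 1 - i \<in> S))"
    unfolding admissible_def rotate_diagram_def by (simp add: case_prod_beta)
  also have "\<dots> \<longleftrightarrow> admissible D {x. 2 * n + 1 - x \<notin> S}"
    unfolding admissible_def
  proof (rule ball_cong[OF refl], clarify)
    fix i j m assume "(i, j, m) \<in> D"
    then have "even (2 * n + 1 - i) \<longleftrightarrow> odd i" "even (2 * n + 1 - j) \<longleftrightarrow> odd j"
      using diagram_bounds[OF D, of i j m] by auto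
    then show "(if m then (2 * n + 1 - j \<in> S \<longleftrightarrow> even (2 * n + 1 - j)) \<and>
        (2 * n + 1 - i \<in> S \<longleftrightarrow> even (2 * n + 1 - i))
      else (2 * n + 1 - j \<in> S \<longleftrightarrow> 2 * n + 1 - i \<in> S)) \<longleftrightarrow>
      (if m then (i \<in> {x. 2 * n + 1 - x \<notin> S} \<longleftrightarrow> even i) \<and> (j \<in> {x. 2 * n + 1 - x \<notin> S} \<longleftrightarrow> even j)
       else (i \<in> {x. 2 * n + 1 - x \<notin> S} \<longleftrightarrow> j \<in> {x. 2 * n + 1 - x \<notin> S}))"
      by auto
  qed
  finally show ?thesis .
qed

subsection \<open>The value of a circle as a number of states\<close>

text \<open>The entry at row \<open>u\<close> and column \<open>v\<close> of the product of the
  matrices of the marks is 1 or 0, and this says that it is 1. \<open>True\<close> is the index 1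
  and \<open>False\<close> the index 2.\<close>

fun path :: "bool \<Rightarrow> mark list \<Rightarrow> bool \<Rightarrow> bool" where
  "path u [] v \<longleftrightarrow> u = v"
| "path u (Dot # ms) v \<longleftrightarrow> u \<and> path False ms v"
| "path u (Cross # ms) v \<longleftrightarrow> \<not> u \<and> path True ms v"

lemma path_append: "path u (xs @ ys) v \<longleftrightarrow> (\<exists>w. path u xs w \<and> path w ys v)"
  by (induction u xs v rule: path.induct) auto

text \<open>Each row of such a matrix product has at most one nonzero entry.\<close>

lemma path_deterministic: "path u ms v \<Longrightarrow> path u ms v' \<Longrightarrow> v = v'"
  by (induction u ms v rule: path.induct) auto

text \<open>The product of \<open>k\<close> blocks expanded over the intermediate indices
  \<open>w\<close>.\<close>

lemma path_concat:
  "path u (concat (map f [0..<k])) v \<longleftrightarrow>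
     (\<exists>w. w 0 = u \<and> w k = v \<and> (\<forall>i<k. path (w i) (f i) (w (Suc i))))"
proof (induction k arbitrary: v)
  case 0
  have "\<exists>w. w 0 = u \<and> w 0 = u" by (rule exI[of _ "\<lambda>_. u"]) simp
  then show ?case by auto
next
  case (Suc k)
  show ?case
  proof
    assume "path u (concat (map f [0..<Suc k])) v"
    then obtain w where w: "w 0 = u" "\<forall>i<k. path (w i) (f i) (w (Suc i))" "path (w k) (f k) v"
      by (auto simp: path_append Suc)
    then have "(w(Suc k := v)) 0 = u \<and> (w(Suc k := v)) (Suc k) = v \<and>
      (\<forall>i<Suc k. path ((w(Suc k := v)) i) (f i) ((w(Suc k := v)) (Suc i)))"
      by (auto simp: less_Suc_eq)
    then show "\<exists>w. w 0 = u \<and> w (Suc k) = v \<and> (\<forall>i<Suc k. path (w i) (f i) (w (Suc i)))"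
      by (rule exI[of _ "w(Suc k := v)"])
  next
    assume "\<exists>w. w 0 = u \<and> w (Suc k) = v \<and> (\<forall>i<Suc k. path (w i) (f i) (w (Suc i)))"
    then show "path u (concat (map f [0..<Suc k])) v"
    proof (elim exE conjE)
      fix w assume w: "w 0 = u" "w (Suc k) = v" "\<forall>i<Suc k. path (w i) (f i) (w (Suc i))"
      then have "path u (concat (map f [0..<k])) (w k)"
        unfolding Suc by (intro exI[of _ w]) simp
      moreover have "path (w k) (f k) v" using w by blast
      ultimately show ?thesis by (auto simp: path_append)
    qed
  qed
qed

text \<open>The current index dictates the next mark, and each mark flips the index. The first index
  therefore fixes all marks, and the parity of the length fixes the last index.\<close>

lemma path_iff_nth:
  "path u ms v \<longleftrightarrow>
     (\<forall>i<length ms. ms ! i = (if even i \<longleftrightarrow> u then Dot else Cross)) \<and> (v \<longleftrightarrow> (even (length ms) \<longleftrightarrow> u))"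
proof (induction u ms v rule: path.induct)
  case (2 u ms v)
  then show ?case by (auto simp: All_less_Suc2)
next
  case (3 u ms v)
  then show ?case by (auto simp: All_less_Suc2)
qed auto

text \<open>A dot lowers the index from \<open>True\<close> to \<open>False\<close> and a cross
  raises it, so the difference telescopes.\<close>

lemma path_count:
  "path u ms v \<Longrightarrow>
     int (count_list ms Dot) - int (count_list ms Cross) = of_bool u - of_bool v"
  by (induction u ms v rule: path.induct) auto

text \<open>Cyclic alternation amounts to alternation along the list together with even length, and
  even length is what makes a path return to its initial index.\<close>

lemma alternating_iff_path:
  assumes "ms \<noteq> []"
  shows "alternating ms \<longleftrightarrow> (\<exists>u. path u ms u)"
proof
  let ?L = "length ms"
  assume alt: "alternating ms"
  have step: "ms ! i \<noteq> ms ! (Suc i mod ?L)" if "i < ?L" for i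
    using alt that unfolding alternating_def by blast
  define u where "u \<longleftrightarrow> ms ! 0 = Dot"
  have nth: "ms ! i = (if even i \<longleftrightarrow> u then Dot else Cross)" if "i < ?L" for i
    using that
  proof (induction i)
    case 0
    then show ?case unfolding u_def by (cases "ms ! 0") auto
  next
    case (Suc i)
    then have "ms ! i = (if even i \<longleftrightarrow> u then Dot else Cross)" "ms ! i \<noteq> ms ! Suc i"
      using step[of i] by auto
    then show ?case by (cases "ms ! Suc i") (auto split: if_splits)
  qed
  have pos: "0 < ?L" using assms by simp
  \<comment> \<open>The wrap-around comparison of the last mark with the first excludes odd length,
    including length 1.\<close>
  then have "ms ! (?L - 1) \<noteq> ms ! 0" using step[of "?L - 1"] by simp
  then have "even ?L" using nth[of "?L - 1"] nth[of 0] pos by (auto split: if_splits)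
  then have "path u ms u" using nth by (simp add: path_iff_nth)
  then show "\<exists>u. path u ms u" ..
next
  assume "\<exists>u. path u ms u"
  then obtain u where nth: "\<forall>i<length ms. ms ! i = (if even i \<longleftrightarrow> u then Dot else Cross)"
    and len: "even (length ms)"
    unfolding path_iff_nth by blast
  show "alternating ms"
    unfolding alternating_def
  proof (intro allI impI)
    fix i assume "i < length ms"
    \<comment> \<open>Reduction modulo an even length preserves parity, so the wrap-around also
      changes the parity of the position.\<close>
    moreover have "even (Suc i mod length ms) \<longleftrightarrow> odd i" using len by (simp add: dvd_mod_iff)
    moreover have "Suc i mod length ms < length ms" using assms by simp
    ultimately show "ms ! i \<noteq> ms ! (Suc i mod length ms)" using nth by auto
  qed
qed

text \<open>The right-hand side is the trace of the product. It is 2 for the empty product.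
  Otherwise the first mark fixes the index \<open>u\<close>, so the trace is at most 1, and a closed
  path makes the two counts equal by itself.\<close>

lemma circle_value_eq_card: "circle_value ms = int (card {u. path u ms u})"
proof (cases "ms = []")
  case True
  then show ?thesis by (simp add: circle_value_def)
next
  case False
  show ?thesis
  proof (cases "\<exists>u. path u ms u")
    case True
    then obtain u where u: "path u ms u" by blast
    have "v = u" if "path v ms v" for v
    proof -
      have "ms ! 0 = (if u then Dot else Cross)" "ms ! 0 = (if v then Dot else Cross)"
        using u that False unfolding path_iff_nth by auto
      then show ?thesis by (auto split: if_splits)
    qed
    then have "{u. path u ms u} = {u}" using u by blast
    moreover have "count_list ms Dot = count_list ms Cross" using path_count[OF u] by simp
    ultimately show ?thesis
      using False alternating_iff_path[OF False] True by (simp add: circle_value_def)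
  next
    case no: False
    then show ?thesis using False alternating_iff_path[OF False] by (simp add: circle_value_def)
  qed
qed

subsection \<open>Circles\<close>

text \<open>\<open>c\<close> stands for the second diagram after rotation; its marks are the
  crosses.\<close>

locale glued_diagrams =
  fixes n :: nat and a c :: diagram
  assumes a: "a \<in> diagrams n" and c: "c \<in> diagrams n"
begin

text \<open>Passes along one arc of each diagram. Both arcs change the parity, so iterating visits
  only points of one parity on a circle.\<close>

definition step :: "nat \<Rightarrow> nat" where
  "step = partner c \<circ> partner a"

definition orbit :: "nat \<Rightarrow> nat set" where
  "orbit p = range (\<lambda>i. (step ^^ i) p)"

definition linked :: "(nat \<times> nat) set" where
  "linked = (joins a \<union> joins c)\<^sup>*"

definition circle_set :: "nat set set" where
  "circle_set = {1..2 * n} // linked"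

definition local_states :: "nat set \<Rightarrow> nat set set" where
  "local_states Z = {T. T \<subseteq> Z \<and> (\<forall>x \<in> Z. admissible_at a T x \<and> admissible_at c T x)}"

definition dots :: "nat \<Rightarrow> mark list" where
  "dots x = (if marked a x then [Dot] else [])"

definition crosses :: "nat \<Rightarrow> mark list" where
  "crosses x = (if marked c (partner a x) then [Cross] else [])"

definition marks :: "nat \<Rightarrow> mark list" where
  "marks p = concat (map (\<lambda>x. dots x @ crosses x) (support step p))"

section \<open>Orbits of the step permutation\<close>

lemma step_permutation: "permutation step"
  unfolding step_def permutation_permutes
  using permutes_compose[OF partner_permutes[OF a] partner_permutes[OF c]] by blast

lemma step_in:
  assumes "p \<in> {1..2 * n}"
  shows "step p \<in> {1..2 * n}" "even (step p) \<longleftrightarrow> even p"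
  using partner_in[OF c partner_in[OF a assms]] partner_parity[OF c partner_in[OF a assms]]
    partner_parity[OF a assms]
  by (simp_all add: step_def)

lemma orbit_self: "p \<in> orbit p"
  unfolding orbit_def by (rule range_eqI[of _ _ 0]) simp

lemma orbit_step:
  assumes "x \<in> orbit p" shows "step x \<in> orbit p"
proof -
  obtain i where "x = (step ^^ i) p" using assms unfolding orbit_def by blast
  then have "step x = (step ^^ Suc i) p" by simp
  then show ?thesis unfolding orbit_def by (rule range_eqI)
qed

lemma orbit_funpow:
  assumes "x \<in> orbit p"
  obtains i where "i < least_power step p" "x = (step ^^ i) p"
proof -
  have "x \<in> set (support step p)"
    using assms unfolding orbit_def support_set[OF step_permutation] .
  then show ?thesis using that by auto
qed

lemma orbit_step_preimage:
  assumes "x \<in> orbit p"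
  obtains y where "y \<in> orbit p" "x = step y"
proof -
  obtain i where i: "x = (step ^^ i) p" using assms unfolding orbit_def by blast
  show ?thesis
  proof (cases i)
    case 0
    \<comment> \<open>The predecessor of \<open>p\<close> is the last point before the first return
      to \<open>p\<close>.\<close>
    obtain k where k: "least_power step p = Suc k"
      using least_power_of_permutation(2)[OF step_permutation, of p] gr0_implies_Suc by blast
    then have "x = step ((step ^^ k) p)"
      using i 0 least_power_of_permutation(1)[OF step_permutation, of p] by simp
    then show ?thesis using that unfolding orbit_def by blast
  next
    case (Suc k)
    then have "x = step ((step ^^ k) p)" using i by simp
    then show ?thesis using that unfolding orbit_def by blast
  qed
qed

lemma orbit_in:
  assumes "p \<in> {1..2 * n}" "x \<in> orbit p"
  shows "x \<in> {1..2 * n}" "even x \<longleftrightarrow> even p"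
proof -
  have "(step ^^ i) p \<in> {1..2 * n} \<and> (even ((step ^^ i) p) \<longleftrightarrow> even p)" for i
  proof (induction i)
    case (Suc i)
    then show ?case using step_in[of "(step ^^ i) p"] by simp
  qed (use assms in simp)
  then show "x \<in> {1..2 * n}" "even x \<longleftrightarrow> even p"
    using assms(2) unfolding orbit_def by blast+
qed

section \<open>Circles as classes of linked points\<close>

lemma linked_sym: "(x, y) \<in> linked \<Longrightarrow> (y, x) \<in> linked"
proof -
  have "sym (joins a \<union> joins c)" unfolding sym_def joins_def by blast
  then show "(x, y) \<in> linked \<Longrightarrow> (y, x) \<in> linked"
    unfolding linked_def using sym_rtrancl symD by fast
qed

lemma linked_trans: "(x, y) \<in> linked \<Longrightarrow> (y, z) \<in> linked \<Longrightarrow> (x, z) \<in> linked"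
  unfolding linked_def by (rule rtrancl_trans)

lemma linked_partner:
  assumes "x \<in> {1..2 * n}"
  shows "(x, partner a x) \<in> linked" "(x, partner c x) \<in> linked"
  using assms joins_iff[OF a] joins_iff[OF c] unfolding linked_def by (auto intro: r_into_rtrancl)

text \<open>The orbit contains the points of the circle with the parity of \<open>p\<close>, and its
  image under \<open>partner a\<close> the others. The union is closed under both involutions, and
  all of it can be reached from \<open>p\<close>.\<close>

lemma linked_class:
  assumes p: "p \<in> {1..2 * n}"
  shows "linked `` {p} = orbit p \<union> partner a ` orbit p"
proof
  let ?Z = "orbit p \<union> partner a ` orbit p"
  have closed: "partner a x \<in> ?Z" "partner c x \<in> ?Z" if x: "x \<in> ?Z" for x
  proof -
    consider "x \<in> orbit p" | y where "y \<in> orbit p" "x = partner a y" using x by blast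
    then show "partner a x \<in> ?Z"
      by cases (auto simp: partner_partner[OF a])
    consider y where "y \<in> orbit p" "x = step y" | y where "y \<in> orbit p" "x = partner a y"
      using x orbit_step_preimage by blast
    then show "partner c x \<in> ?Z"
    proof cases
      case (1 y)
      then show ?thesis by (simp add: step_def partner_partner[OF c])
    next
      case (2 y)
      then show ?thesis using orbit_step[OF 2(1)] by (simp add: step_def)
    qed
  qed
  show "linked `` {p} \<subseteq> ?Z"
  proof
    fix x assume "x \<in> linked `` {p}"
    then have "(p, x) \<in> (joins a \<union> joins c)\<^sup>*" unfolding linked_def by blast
    then show "x \<in> ?Z"
    proof induction
      case base
      then show ?case using orbit_self by blast
    next
      case (step y z)
      then have "z = partner a y \<or> z = partner c y"
        using joins_iff[OF a] joins_iff[OF c] by blast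
      then show ?case using closed[OF step.IH] by metis
    qed
  qed
  have "(p, (step ^^ i) p) \<in> linked" for i
  proof (induction i)
    case 0
    then show ?case by (simp add: linked_def)
  next
    case (Suc i)
    let ?x = "(step ^^ i) p"
    have x: "?x \<in> {1..2 * n}" using orbit_in(1)[OF p, of ?x] unfolding orbit_def by blast
    have "(?x, step ?x) \<in> linked"
      using linked_trans[OF linked_partner(1)[OF x] linked_partner(2)[OF partner_in[OF a x]]]
      by (simp add: step_def)
    then show ?case using linked_trans[OF Suc] by simp
  qed
  then have "(p, x) \<in> linked" if "x \<in> orbit p" for x
    using that unfolding orbit_def by blast
  then show "?Z \<subseteq> linked `` {p}"
    using linked_trans[OF _ linked_partner(1)[OF orbit_in(1)[OF p]]] by blast
qed

lemma circle_class:
  assumes "Z \<in> circle_set" "x \<in> Z"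
  shows "x \<in> {1..2 * n}" "Z = linked `` {x}"
proof -
  obtain p where p: "p \<in> {1..2 * n}" "Z = linked `` {p}"
    using assms(1) unfolding circle_set_def by (rule quotientE)
  show "x \<in> {1..2 * n}"
    using assms(2) orbit_in(1)[OF p(1)] partner_in[OF a orbit_in(1)[OF p(1)]]
    unfolding p(2) linked_class[OF p(1)] by blast
  have "(p, x) \<in> linked" using assms(2) p(2) by blast
  then show "Z = linked `` {x}"
    unfolding p(2) using linked_sym linked_trans by blast
qed

lemma circle_closed:
  assumes "Z \<in> circle_set" "x \<in> Z"
  shows "partner a x \<in> Z" "partner c x \<in> Z"
  using circle_class[OF assms] linked_partner by blast+

lemma circle_unique:
  assumes "Z \<in> circle_set" "Z' \<in> circle_set" "x \<in> Z" "x \<in> Z'"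
  shows "Z = Z'"
  using circle_class(2)[OF assms(1,3)] circle_class(2)[OF assms(2,4)] by simp

lemma circle_exists:
  assumes "x \<in> {1..2 * n}"
  obtains Z where "Z \<in> circle_set" "x \<in> Z"
proof (rule that)
  show "linked `` {x} \<in> circle_set" unfolding circle_set_def by (rule quotientI[OF assms])
  show "x \<in> linked `` {x}" unfolding linked_def by blast
qed

lemma circle_subset: "Z \<in> circle_set \<Longrightarrow> Z \<subseteq> {1..2 * n}"
  using circle_class(1) by blast

lemma circle_nonempty: "Z \<in> circle_set \<Longrightarrow> Z \<noteq> {}"
  unfolding circle_set_def linked_def by (auto elim!: quotientE)

lemma finite_circle_set: "finite circle_set"
proof (rule finite_subset)
  show "circle_set \<subseteq> Pow {1..2 * n}" using circle_subset by blast
qed simp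

section \<open>Admissible states of a single circle\<close>

text \<open>\<open>x \<in> T \<longleftrightarrow> even p\<close> is the matrix index at
  \<open>x\<close>. Orbit points share the parity of \<open>p\<close> and their partners have the
  other one, so a dotted arc leads from index \<open>True\<close> to \<open>False\<close>, a crossed
  arc from \<open>False\<close> to \<open>True\<close>, and an unmarked arc keeps the index.
  Comparing with the parity of \<open>p\<close> covers both directions of travel.\<close>

lemma admissible_at_path:
  assumes p: "p \<in> {1..2 * n}" and x: "x \<in> orbit p"
  shows "admissible_at a T x \<and> admissible_at a T (partner a x) \<longleftrightarrow>
      path (x \<in> T \<longleftrightarrow> even p) (dots x) (partner a x \<in> T \<longleftrightarrow> even p)"
    and "admissible_at c T (partner a x) \<and> admissible_at c T (step x) \<longleftrightarrow>
      path (partner a x \<in> T \<longleftrightarrow> even p) (crosses x) (step x \<in> T \<longleftrightarrow> even p)"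
proof -
  have xN: "x \<in> {1..2 * n}" and xp: "even x \<longleftrightarrow> even p" using orbit_in[OF p x] by auto
  note yN = partner_in[OF a xN]
  have yp: "even (partner a x) \<longleftrightarrow> odd p" using partner_parity[OF a xN] xp by simp
  show "admissible_at a T x \<and> admissible_at a T (partner a x) \<longleftrightarrow>
      path (x \<in> T \<longleftrightarrow> even p) (dots x) (partner a x \<in> T \<longleftrightarrow> even p)"
    unfolding admissible_at_def dots_def marked_partner[OF a xN] partner_partner[OF a] xp yp
    by (cases "marked a x") auto
  have zp: "even (step x) \<longleftrightarrow> even p" using step_in(2)[OF xN] xp by simp
  have zc: "partner c (partner a x) = step x" "partner c (step x) = partner a x"
    by (simp_all add: step_def partner_partner[OF c])
  have zm: "marked c (step x) \<longleftrightarrow> marked c (partner a x)"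
    using marked_partner[OF c yN] by (simp add: step_def)
  show "admissible_at c T (partner a x) \<and> admissible_at c T (step x) \<longleftrightarrow>
      path (partner a x \<in> T \<longleftrightarrow> even p) (crosses x) (step x \<in> T \<longleftrightarrow> even p)"
    unfolding admissible_at_def crosses_def zc zm yp zp
    by (cases "marked c (partner a x)") auto
qed

text \<open>Regroups the conditions at single points into one condition for each arc of the
  circle.\<close>

lemma local_states_path:
  assumes p: "p \<in> {1..2 * n}"
  shows "T \<in> local_states (linked `` {p}) \<longleftrightarrow> T \<subseteq> linked `` {p} \<and>
    (\<forall>x \<in> orbit p.
      path (x \<in> T \<longleftrightarrow> even p) (dots x) (partner a x \<in> T \<longleftrightarrow> even p) \<and>
      path (partner a x \<in> T \<longleftrightarrow> even p) (crosses x) (step x \<in> T \<longleftrightarrow> even p))"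
    (is "_ \<longleftrightarrow> _ \<and> (\<forall>x \<in> orbit p. ?P x)")
proof -
  let ?adm = "\<lambda>x. admissible_at a T x \<and> admissible_at c T x"
  have P: "?P x \<longleftrightarrow> (admissible_at a T x \<and> admissible_at a T (partner a x)) \<and>
      (admissible_at c T (partner a x) \<and> admissible_at c T (step x))" if "x \<in> orbit p" for x
    unfolding admissible_at_path[OF p that] ..
  have "(\<forall>x \<in> orbit p \<union> partner a ` orbit p. ?adm x) \<longleftrightarrow> (\<forall>x \<in> orbit p. ?P x)"
  proof
    assume "\<forall>x \<in> orbit p \<union> partner a ` orbit p. ?adm x"
    then show "\<forall>x \<in> orbit p. ?P x" using P orbit_step by blast
  next
    assume all: "\<forall>x \<in> orbit p. ?P x"
    show "\<forall>x \<in> orbit p \<union> partner a ` orbit p. ?adm x"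
    proof
      fix x assume "x \<in> orbit p \<union> partner a ` orbit p"
      then show "?adm x"
      proof
        assume x: "x \<in> orbit p"
        \<comment> \<open>The arc of \<open>c\<close> at \<open>x\<close> is the one that the step
          from \<open>y\<close> traverses.\<close>
        then obtain y where y: "y \<in> orbit p" "x = step y" by (rule orbit_step_preimage)
        then show ?thesis using P[OF x] P[OF y(1)] all x by blast
      next
        assume "x \<in> partner a ` orbit p"
        then show ?thesis using P all by blast
      qed
    qed
  qed
  then show ?thesis unfolding local_states_def linked_class[OF p] by blast
qed

text \<open>A local state is determined by its index at \<open>p\<close>, since each arc passes the
  index on. The possible indices at \<open>p\<close> are those that recur after a full turn, which
  the trace counts.\<close>

lemma card_local_states:
  assumes p: "p \<in> {1..2 * n}"
  shows "int (card (local_states (linked `` {p}))) = circle_value (marks p)"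
proof -
  define k where "k = least_power step p"
  define q where "q = (\<lambda>i. (step ^^ i) p)"
  define t where "t = (\<lambda>T (x :: nat). x \<in> T \<longleftrightarrow> even p)"
  let ?V = "local_states (linked `` {p})"
  have q0: "q 0 = p" and qSuc: "q (Suc i) = step (q i)" and qk: "q k = p" for i
    using least_power_of_permutation(1)[OF step_permutation] by (simp_all add: q_def k_def)
  have q_orbit: "q i \<in> orbit p" for i unfolding q_def orbit_def by blast
  have marks_eq: "marks p = concat (map (\<lambda>i. dots (q i) @ crosses (q i)) [0..<k])"
    unfolding marks_def q_def k_def by (simp add: comp_def)
  have VD: "path (t T x) (dots x) (t T (partner a x))"
    "path (t T (partner a x)) (crosses x) (t T (step x))"
    if "T \<in> ?V" "x \<in> orbit p" for T x
    using that unfolding local_states_path[OF p] t_def by blast+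
  have "bij_betw (\<lambda>T. t T p) ?V {u. path u (marks p) u}"
    unfolding bij_betw_def
  proof (intro conjI subset_antisym)
    show "inj_on (\<lambda>T. t T p) ?V"
    proof (rule inj_onI)
      fix T T' assume T: "T \<in> ?V" and T': "T' \<in> ?V" and eq: "t T p = t T' p"
      have mid: "t T (partner a x) = t T' (partner a x)" if "t T x = t T' x" "x \<in> orbit p" for x
        using path_deterministic VD(1)[OF T that(2)] VD(1)[OF T' that(2)] that(1) by simp
      have "t T (q i) = t T' (q i)" for i
      proof (induction i)
        case 0
        then show ?case using eq by (simp add: q0)
      next
        case (Suc i)
        then show ?case
          using path_deterministic VD(2)[OF T q_orbit, of i] VD(2)[OF T' q_orbit, of i]
            mid[OF Suc q_orbit]
          unfolding qSuc by simp
      qed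
      then have orb: "t T x = t T' x" if "x \<in> orbit p" for x
        using that unfolding orbit_def q_def by blast
      then have "t T x = t T' x" if "x \<in> linked `` {p}" for x
        using that mid unfolding linked_class[OF p] by blast
      moreover have "T \<subseteq> linked `` {p}" "T' \<subseteq> linked `` {p}"
        using T T' unfolding local_states_def by blast+
      ultimately show "T = T'" unfolding t_def by blast
    qed
  next
    show "(\<lambda>T. t T p) ` ?V \<subseteq> {u. path u (marks p) u}"
    proof (rule image_subsetI, rule CollectI)
      fix T assume T: "T \<in> ?V"
      have "path (t T (q i)) (dots (q i) @ crosses (q i)) (t T (q (Suc i)))" for i
        unfolding path_append qSuc using VD[OF T q_orbit] by blast
      then show "path (t T p) (marks p) (t T p)"
        unfolding marks_eq path_concat by (intro exI[of _ "\<lambda>i. t T (q i)"]) (simp add: q0 qk)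
    qed
  next
    show "{u. path u (marks p) u} \<subseteq> (\<lambda>T. t T p) ` ?V"
    proof
      fix u assume "u \<in> {u. path u (marks p) u}"
      then have "path u (marks p) u" by (rule CollectD)
      then obtain w where w: "w 0 = u" "w k = u"
        and "\<forall>i<k. path (w i) (dots (q i) @ crosses (q i)) (w (Suc i))"
        unfolding marks_eq path_concat by (elim exE conjE)
      \<comment> \<open>The block at \<open>q i\<close> consists of an arc of \<open>a\<close> and
        an arc of \<open>c\<close>. The index between them, chosen as \<open>m i\<close>, belongs to
        the point \<open>partner a (q i)\<close>.\<close>
      then have "\<forall>i. \<exists>v. i < k \<longrightarrow> path (w i) (dots (q i)) v \<and> path v (crosses (q i)) (w (Suc i))"
        unfolding path_append by blast
      then obtain m where m: "\<And>i. i < k \<Longrightarrow> path (w i) (dots (q i)) (m i)"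
        "\<And>i. i < k \<Longrightarrow> path (m i) (crosses (q i)) (w (Suc i))"
        by (metis (no_types, lifting))
      \<comment> \<open>The points before the first return are distinct, so \<open>ind\<close> can
        recover the position of a point in the orbit.\<close>
      have "inj_on q {..<k}"
        using cycle_of_permutation[OF step_permutation, of p]
        unfolding q_def k_def distinct_map by (simp add: atLeast0LessThan)
      then obtain ind where ind: "\<And>i. i < k \<Longrightarrow> ind (q i) = i"
        using the_inv_into_f_f[of q "{..<k}"] by (metis lessThan_iff)
      \<comment> \<open>The partner has the opposite parity to \<open>p\<close>. Hence the two
        pieces of \<open>T\<close> below do not interfere.\<close>
      have A_notin: "partner a x \<notin> orbit p" if "x \<in> orbit p" for x
        using orbit_in[OF p that] partner_parity[OF a orbit_in(1)[OF p that]]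
          orbit_in(2)[OF p, of "partner a x"] by blast
      \<comment> \<open>Decodes the indices along the closed path into a state: \<open>w\<close> at
        the orbit points and \<open>m\<close> at their partners.\<close>
      define T where "T = {x \<in> orbit p. w (ind x) \<longleftrightarrow> even p} \<union>
        {x \<in> partner a ` orbit p. m (ind (partner a x)) \<longleftrightarrow> even p}"
      have "t T (q i) = w i" if "i < k" for i
      proof -
        have "q i \<notin> partner a ` orbit p" using A_notin q_orbit[of i] by auto
        then show ?thesis using q_orbit[of i] ind[OF that] unfolding t_def T_def by auto
      qed
      moreover have "0 < k"
        unfolding k_def by (rule least_power_of_permutation(2)[OF step_permutation])
      \<comment> \<open>The bound includes \<open>k\<close>: there \<open>q k = q 0\<close>, and the
        closing condition gives \<open>w k = w 0\<close>.\<close>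
      ultimately have tq: "t T (q i) = w i" if "i \<le> k" for i
        using that w q0 qk by (metis le_neq_implies_less)
      have tm: "t T (partner a (q i)) = m i" if "i < k" for i
        using A_notin[OF q_orbit[of i]] q_orbit[of i] ind[OF that] partner_partner[OF a]
        unfolding t_def T_def by auto
      have "T \<in> ?V"
        unfolding local_states_path[OF p]
      proof (intro conjI ballI)
        show "T \<subseteq> linked `` {p}" unfolding T_def linked_class[OF p] by blast
      next
        fix x assume "x \<in> orbit p"
        then obtain i where i: "i < k" "x = q i"
          using orbit_funpow unfolding k_def q_def by metis
        show "path (x \<in> T \<longleftrightarrow> even p) (dots x) (partner a x \<in> T \<longleftrightarrow> even p)"
          using m(1)[OF i(1)] tq[of i] tm[OF i(1)] i unfolding t_def by simp
        show "path (partner a x \<in> T \<longleftrightarrow> even p) (crosses x) (step x \<in> T \<longleftrightarrow> even p)"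
          using m(2)[OF i(1)] tq[of "Suc i"] tm[OF i(1)] i unfolding t_def qSuc by simp
      qed
      moreover have "t T p = u" using tq[of 0] w(1) q0 by simp
      ultimately show "u \<in> (\<lambda>T. t T p) ` ?V" by blast
    qed
  qed
  then show ?thesis unfolding circle_value_eq_card by (simp add: bij_betw_same_card)
qed

section \<open>From states of the circles to states of all points\<close>

lemma admissible_at_circle:
  assumes "Z \<in> circle_set" "x \<in> Z"
  shows "admissible_at a (S \<inter> Z) x \<longleftrightarrow> admissible_at a S x"
    "admissible_at c (S \<inter> Z) x \<longleftrightarrow> admissible_at c S x"
  using assms(2) circle_closed[OF assms] unfolding admissible_at_def by auto

text \<open>Admissibility at a point involves only that point and its two partners, which lie on the
  same circle. A state is thus an independent choice of a local state on each circle.\<close>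

lemma card_admissible:
  "card {S \<in> Pow {1..2 * n}. admissible a S \<and> admissible c S} =
    (\<Prod>Z \<in> circle_set. card (local_states Z))"
proof -
  let ?X = "{S \<in> Pow {1..2 * n}. admissible a S \<and> admissible c S}"
  let ?r = "\<lambda>S. restrict (\<lambda>Z. S \<inter> Z) circle_set"
  have "bij_betw ?r ?X (PiE circle_set local_states)"
    unfolding bij_betw_def
  proof (intro conjI subset_antisym)
    show "inj_on ?r ?X"
    proof (rule inj_onI)
      fix S S' assume S: "S \<in> ?X" and S': "S' \<in> ?X" and eq: "?r S = ?r S'"
      have inter: "S \<inter> Z = S' \<inter> Z" if "Z \<in> circle_set" for Z
        using fun_cong[OF eq, of Z] that by simp
      have "x \<in> S \<longleftrightarrow> x \<in> S'" if x: "x \<in> {1..2 * n}" for x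
      proof -
        obtain Z where "Z \<in> circle_set" "x \<in> Z" using x by (rule circle_exists)
        then show ?thesis using inter[of Z] by blast
      qed
      then show "S = S'" using S S' by blast
    qed
  next
    show "?r ` ?X \<subseteq> PiE circle_set local_states"
    proof (rule image_subsetI)
      fix S assume S: "S \<in> ?X"
      show "?r S \<in> PiE circle_set local_states"
      proof (rule restrict_PiE_iff[THEN iffD2], rule ballI)
        fix Z assume Z: "Z \<in> circle_set"
        have "admissible_at a S x \<and> admissible_at c S x" if "x \<in> Z" for x
          using S that circle_subset[OF Z] unfolding mem_Collect_eq admissible_iff_at[OF a] admissible_iff_at[OF c]
          by blast
        then show "S \<inter> Z \<in> local_states Z"
          unfolding local_states_def using admissible_at_circle[OF Z] by auto
      qed
    qed
  next
    show "PiE circle_set local_states \<subseteq> ?r ` ?X"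
    proof
      fix F assume F: "F \<in> PiE circle_set local_states"
      have FZ: "F Z \<in> local_states Z" "F Z \<subseteq> Z" if "Z \<in> circle_set" for Z
        using PiE_mem[OF F that] unfolding local_states_def by blast+
      \<comment> \<open>The inverse map glues the local states; distinct circles are disjoint, so
        each local state can be read off again.\<close>
      define S where "S = (\<Union>Z \<in> circle_set. F Z)"
      have SZ: "S \<inter> Z = F Z" if Z: "Z \<in> circle_set" for Z
      proof
        show "S \<inter> Z \<subseteq> F Z"
        proof
          fix x assume x: "x \<in> S \<inter> Z"
          then obtain Z' where Z': "Z' \<in> circle_set" "x \<in> F Z'" unfolding S_def by blast
          then have "Z' = Z" using circle_unique[OF Z'(1) Z, of x] FZ(2)[OF Z'(1)] x by blast
          then show "x \<in> F Z" using Z' by simp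
        qed
        show "F Z \<subseteq> S \<inter> Z" using Z FZ(2)[OF Z] unfolding S_def by blast
      qed
      have "admissible_at a S x \<and> admissible_at c S x" if x: "x \<in> {1..2 * n}" for x
      proof -
        obtain Z where Z: "Z \<in> circle_set" "x \<in> Z" using x by (rule circle_exists)
        then have "admissible_at a (F Z) x \<and> admissible_at c (F Z) x"
          using FZ(1)[OF Z(1)] unfolding local_states_def by blast
        then show ?thesis using admissible_at_circle[OF Z, of S] SZ[OF Z(1)] by simp
      qed
      then have "admissible a S" "admissible c S"
        unfolding admissible_iff_at[OF a] admissible_iff_at[OF c] by blast+
      moreover have "S \<subseteq> {1..2 * n}" unfolding S_def using FZ(2) circle_subset by blast
      ultimately have "S \<in> ?X" by blast
      moreover have "F = ?r S"
      proof
        show "F Z = ?r S Z" for Z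
          using SZ[of Z] PiE_arb[OF F, of Z] by (cases "Z \<in> circle_set") auto
      qed
      ultimately show "F \<in> ?r ` ?X" by blast
    qed
  qed
  then have "card ?X = card (PiE circle_set local_states)" by (rule bij_betw_same_card)
  also have "\<dots> = (\<Prod>Z \<in> circle_set. card (local_states Z))"
    by (rule card_PiE[OF finite_circle_set])
  finally show ?thesis .
qed

text \<open>The number of local states depends on the circle as a set only, so it can be computed
  from the starting point \<open>Min Z\<close>.\<close>

lemma prod_circle_value:
  "(\<Prod>Z \<in> circle_set. circle_value (marks (Min Z))) =
    int (card {S \<in> Pow {1..2 * n}. admissible a S \<and> admissible c S})"
proof -
  have "circle_value (marks (Min Z)) = int (card (local_states Z))" if Z: "Z \<in> circle_set" for Z
  proof -
    have "Min Z \<in> Z"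
      using finite_subset[OF circle_subset[OF Z]] circle_nonempty[OF Z] by (intro Min_in) simp_all
    then have "Min Z \<in> {1..2 * n}" "linked `` {Min Z} = Z"
      using circle_class[OF Z] by auto
    then show ?thesis using card_local_states by metis
  qed
  then show ?thesis unfolding card_admissible by simp
qed

end

text \<open>Multiplies out the traces. The circles disappear, and what remains is one condition on
  each diagram.\<close>

lemma pairing_eq_card:
  assumes a: "a \<in> diagrams n" and b: "b \<in> diagrams n"
  shows "pairing n a b =
    int (card {S \<in> Pow {1..2 * n}. admissible a S \<and> admissible (rotate_diagram n b) S})"
proof -
  interpret glued_diagrams n a "rotate_diagram n b"
    using a rotate_diagram_in[OF b] by unfold_locales
  have "circle_marks n a b p = marks p" for p
    unfolding circle_marks_def marks_def dots_def crosses_def step_def ..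
  moreover have "circles n a b = circle_set"
    unfolding circles_def circle_set_def linked_def ..
  ultimately show ?thesis using prod_circle_value by (simp add: pairing_def)
qed

subsection \<open>The form on the free abelian group\<close>

text \<open>For a fixed state, the linear extension of the indicator of admissibility from diagrams
  to their combinations.\<close>

definition state_weight :: "(diagram \<Rightarrow>\<^sub>0 int) \<Rightarrow> nat set \<Rightarrow> int" where
  "state_weight x S =
     (\<Sum>a \<in> Poly_Mapping.keys x. Poly_Mapping.lookup x a * of_bool (admissible a S))"

text \<open>Allows the weights of several elements to be summed over one common set of
  diagrams.\<close>

lemma state_weight_superset:
  assumes "finite K" "Poly_Mapping.keys x \<subseteq> K"
  shows "state_weight x S = (\<Sum>a \<in> K. Poly_Mapping.lookup x a * of_bool (admissible a S))"
  unfolding state_weight_def using assms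
  by (intro sum.mono_neutral_left) (auto simp: in_keys_iff)

lemma state_weight_add: "state_weight (x + y) S = state_weight x S + state_weight y S"
proof -
  let ?K = "Poly_Mapping.keys x \<union> Poly_Mapping.keys y"
  have K: "finite ?K" "Poly_Mapping.keys x \<subseteq> ?K" "Poly_Mapping.keys y \<subseteq> ?K"
    "Poly_Mapping.keys (x + y) \<subseteq> ?K"
    using keys_add[of x y] by auto
  show ?thesis
    unfolding state_weight_superset[OF K(1,2)] state_weight_superset[OF K(1,3)]
      state_weight_superset[OF K(1,4)]
    by (simp add: lookup_add distrib_right sum.distrib)
qed

lemma state_weight_uminus: "state_weight (- x) S = - state_weight x S"
  unfolding state_weight_def by (simp add: sum_negf)

lemma state_weight_diff: "state_weight (x - y) S = state_weight x S - state_weight y S"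
  using state_weight_add[of x "- y"] by (simp add: state_weight_uminus)

lemma state_weight_zero: "state_weight 0 S = 0"
  unfolding state_weight_def by simp

lemma state_weight_frag_of: "state_weight (frag_of a) S = of_bool (admissible a S)"
  unfolding state_weight_def by simp

section \<open>The two relations, state by state\<close>

lemma admissible_Un: "admissible (D \<union> E) S \<longleftrightarrow> admissible D S \<and> admissible E S"
  unfolding admissible_def by blast

lemma admissible_pair:
  "admissible {(i, j, m), (k, l, m')} S \<longleftrightarrow>
    (if m then (i \<in> S \<longleftrightarrow> even i) \<and> (j \<in> S \<longleftrightarrow> even j) else (i \<in> S \<longleftrightarrow> j \<in> S)) \<and>
    (if m' then (k \<in> S \<longleftrightarrow> even k) \<and> (l \<in> S \<longleftrightarrow> even l) else (k \<in> S \<longleftrightarrow> l \<in> S))"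
  unfolding admissible_def by simp

text \<open>Call a point good if it lies in \<open>S\<close> exactly when it is even. A dotted arc
  requires two good ends; an undotted one requires exactly one good end, because its ends have
  opposite parity. So each side is 1 if \<open>E\<close> is admissible and exactly three of the four
  points are good, and 0 otherwise.\<close>

lemma type_I_state_weight:
  assumes "type_I n l r"
  shows "state_weight l S = state_weight r S"
  using assms
proof cases
  case (1 a b c d E)
  have "even b \<longleftrightarrow> odd a" "even d \<longleftrightarrow> odd c" "even c \<longleftrightarrow> odd b"
    using diagram_arc_parity[OF 1(6), of a b True] diagram_arc_parity[OF 1(6), of c d False]
      diagram_arc_parity[OF 1(8), of b c False] by simp_all
  then show ?thesis
    unfolding 1(1,2) state_weight_add state_weight_frag_of admissible_Un admissible_pair
    by (cases "a \<in> S"; cases "b \<in> S"; cases "c \<in> S"; cases "d \<in> S"; cases "even a";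
        cases "admissible E S") simp_all
qed

text \<open>Both sides require each of the four points to lie in \<open>S\<close> exactly when it is
  even, however the points are joined.\<close>

lemma type_II_state_weight:
  assumes "type_II n l r"
  shows "state_weight l S = state_weight r S"
  using assms
proof cases
  case (1 a b c d E)
  show ?thesis
    unfolding 1(1,2) state_weight_frag_of admissible_Un admissible_pair by auto
qed

section \<open>The form as a sum over states\<close>

lemma keys_add_subset:
  assumes "Poly_Mapping.keys x \<subseteq> K" "Poly_Mapping.keys y \<subseteq> K"
  shows "Poly_Mapping.keys (x + y) \<subseteq> K"
  using keys_add[of x y] assms by blast

lemma relation_carrier:
  assumes "type_I n l r \<or> type_II n l r"
  shows "Poly_Mapping.keys l \<subseteq> diagrams n" "Poly_Mapping.keys r \<subseteq> diagrams n"
proof -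
  have "Poly_Mapping.keys l \<subseteq> diagrams n \<and> Poly_Mapping.keys r \<subseteq> diagrams n"
    using assms
  proof
    assume "type_I n l r"
    then show ?thesis
      by cases (simp add: keys_add_subset)
  next
    assume "type_II n l r"
    then show ?thesis by cases simp
  qed
  then show "Poly_Mapping.keys l \<subseteq> diagrams n" "Poly_Mapping.keys r \<subseteq> diagrams n" by auto
qed

text \<open>Separates the two arguments: each summand is a product of a linear functional of
  \<open>x\<close> and one of \<open>y\<close>. The form thus sees its arguments only through their
  weights.\<close>

lemma form_eq_states:
  assumes x: "Poly_Mapping.keys x \<subseteq> diagrams n" and y: "Poly_Mapping.keys y \<subseteq> diagrams n"
  shows "form n x y =
    (\<Sum>S \<in> Pow {1..2 * n}. state_weight x S * state_weight y {p. 2 * n + 1 - p \<notin> S})"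
proof -
  let ?X = "Poly_Mapping.keys x" and ?Y = "Poly_Mapping.keys y"
  let ?r = "\<lambda>S. {p. 2 * n + 1 - p \<notin> S}"
  have pairing: "pairing n a b =
      (\<Sum>S \<in> Pow {1..2 * n}. of_bool (admissible a S) * of_bool (admissible b (?r S)))"
    if "a \<in> ?X" "b \<in> ?Y" for a b
  proof -
    have ab: "a \<in> diagrams n" "b \<in> diagrams n" using that x y by auto
    have "pairing n a b =
        int (card (Pow {1..2 * n} \<inter> {S. admissible a S \<and> admissible b (?r S)}))"
      unfolding pairing_eq_card[OF ab] admissible_rotate[OF ab(2)] Int_def mem_Collect_eq ..
    also have "\<dots> = (\<Sum>S \<in> Pow {1..2 * n}. of_bool (admissible a S \<and> admissible b (?r S)))"
      by (subst sum_of_bool_eq) simp_all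
    finally show ?thesis by (simp only: of_bool_conj)
  qed
  have "form n x y = (\<Sum>a \<in> ?X. \<Sum>b \<in> ?Y. \<Sum>S \<in> Pow {1..2 * n}.
      (Poly_Mapping.lookup x a * of_bool (admissible a S)) *
      (Poly_Mapping.lookup y b * of_bool (admissible b (?r S))))"
    unfolding form_def
    by (intro sum.cong refl) (simp only: pairing sum_distrib_left mult_ac)
  also have "\<dots> = (\<Sum>a \<in> ?X. \<Sum>S \<in> Pow {1..2 * n}. \<Sum>b \<in> ?Y.
      (Poly_Mapping.lookup x a * of_bool (admissible a S)) *
      (Poly_Mapping.lookup y b * of_bool (admissible b (?r S))))"
    by (intro sum.cong refl sum.swap)
  also have "\<dots> = (\<Sum>S \<in> Pow {1..2 * n}. \<Sum>a \<in> ?X. \<Sum>b \<in> ?Y.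
      (Poly_Mapping.lookup x a * of_bool (admissible a S)) *
      (Poly_Mapping.lookup y b * of_bool (admissible b (?r S))))"
    by (rule sum.swap)
  also have "\<dots> = (\<Sum>S \<in> Pow {1..2 * n}. state_weight x S * state_weight y (?r S))"
    unfolding state_weight_def sum_product ..
  finally show ?thesis .
qed

lemma form_add_left:
  assumes "Poly_Mapping.keys x \<subseteq> diagrams n" "Poly_Mapping.keys x' \<subseteq> diagrams n"
    "Poly_Mapping.keys y \<subseteq> diagrams n"
  shows "form n (x + x') y = form n x y + form n x' y"
  using assms keys_add_subset[OF assms(1,2)]
  by (simp add: form_eq_states state_weight_add distrib_right sum.distrib)

lemma form_add_right:
  assumes "Poly_Mapping.keys x \<subseteq> diagrams n" "Poly_Mapping.keys y \<subseteq> diagrams n"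
    "Poly_Mapping.keys y' \<subseteq> diagrams n"
  shows "form n x (y + y') = form n x y + form n x y'"
  using assms keys_add_subset[OF assms(2,3)]
  by (simp add: form_eq_states state_weight_add distrib_left sum.distrib)

section \<open>Descent to the quotient\<close>

lemma relation_subgroup_normal: "relation_subgroup n \<lhd> free_Abelian_group (diagrams n)"
proof -
  interpret comm_group "free_Abelian_group (diagrams n)" by (rule abelian_free_Abelian_group)
  have "{l - r |l r. type_I n l r \<or> type_II n l r} \<subseteq> carrier (free_Abelian_group (diagrams n))"
  proof clarify
    fix l r assume "type_I n l r \<or> type_II n l r"
    from relation_carrier[OF this] show "l - r \<in> carrier (free_Abelian_group (diagrams n))"
      using keys_diff[of l r] by auto
  qed
  then have "subgroup (relation_subgroup n) (free_Abelian_group (diagrams n))"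
    unfolding relation_subgroup_def by (rule generate_is_subgroup)
  then show ?thesis by (rule subgroup_imp_normal)
qed

text \<open>Weights are additive and vanish on the generators, hence on everything
  generated.\<close>

lemma relation_subgroup_state_weight:
  assumes "z \<in> relation_subgroup n"
  shows "state_weight z S = 0"
  using assms unfolding relation_subgroup_def
proof (induction rule: generate.induct)
  case one
  then show ?case by (simp add: state_weight_zero)
next
  case (incl h)
  then show ?case
    using type_I_state_weight type_II_state_weight by (auto simp: state_weight_diff)
next
  case (inv h)
  then obtain l r where lr: "h = l - r" "type_I n l r \<or> type_II n l r" by blast
  \<comment> \<open>Membership in the carrier identifies the group inverse of \<open>h\<close> with
    \<open>- h\<close>.\<close>
  have "Poly_Mapping.keys h \<subseteq> diagrams n"
    using relation_carrier[OF lr(2)] keys_diff[of l r] unfolding lr(1) by blast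
  then have "state_weight (inv\<^bsub>free_Abelian_group (diagrams n)\<^esub> h) S = - state_weight h S"
    by (simp add: state_weight_uminus)
  also have "\<dots> = 0"
    using lr type_I_state_weight type_II_state_weight by (auto simp: state_weight_diff)
  finally show ?case .
next
  case (eng h1 h2)
  then show ?case by (simp add: state_weight_add)
qed

lemma coset_of_state_weight:
  assumes "z \<in> coset_of n x"
  shows "state_weight z S = state_weight x S"
  using assms relation_subgroup_state_weight[of _ n S]
  unfolding coset_of_def r_coset_def by (auto simp: state_weight_add)

text \<open>Evaluates the form at arbitrary representatives; the choice is immaterial because
  weights are constant on cosets.\<close>

definition quotient_form ::
    "nat \<Rightarrow> (diagram \<Rightarrow>\<^sub>0 int) set \<Rightarrow> (diagram \<Rightarrow>\<^sub>0 int) set \<Rightarrow> int" where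
  "quotient_form n U V = form n (SOME x. x \<in> U) (SOME y. y \<in> V)"

lemma quotient_form_coset_of:
  assumes x: "x \<in> carrier (free_Abelian_group (diagrams n))"
    and y: "y \<in> carrier (free_Abelian_group (diagrams n))"
  shows "quotient_form n (coset_of n x) (coset_of n y) = form n x y"
proof -
  interpret normal "relation_subgroup n" "free_Abelian_group (diagrams n)"
    by (rule relation_subgroup_normal)
  have some: "(SOME z. z \<in> coset_of n w) \<in> coset_of n w"
    "Poly_Mapping.keys (SOME z. z \<in> coset_of n w) \<subseteq> diagrams n"
    if w: "w \<in> carrier (free_Abelian_group (diagrams n))" for w
  proof -
    have "w \<in> coset_of n w" unfolding coset_of_def by (rule rcos_self[OF w is_subgroup])
    then show *: "(SOME z. z \<in> coset_of n w) \<in> coset_of n w" by (rule someI)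
    then show "Poly_Mapping.keys (SOME z. z \<in> coset_of n w) \<subseteq> diagrams n"
      using elemrcos_carrier[OF is_group w] unfolding coset_of_def by simp
  qed
  show ?thesis
    using x y some[OF x] some[OF y]
    by (simp add: quotient_form_def form_eq_states coset_of_state_weight)
qed

lemma coset_of_mult:
  assumes "x \<in> carrier (free_Abelian_group (diagrams n))"
    "y \<in> carrier (free_Abelian_group (diagrams n))"
  shows "coset_of n x \<otimes>\<^bsub>R n\<^esub> coset_of n y = coset_of n (x + y)"
  using normal.rcos_sum[OF relation_subgroup_normal assms]
  unfolding coset_of_def R_def by simp

lemma bilinear_quotient_form: "bilinear_form (R n) (quotient_form n)"
proof -
  let ?F = "carrier (free_Abelian_group (diagrams n))"
  have carrier: "carrier (R n) = coset_of n ` ?F"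
    unfolding R_def carrier_FactGroup coset_of_def ..
  have add_in: "x + y \<in> ?F" if "x \<in> ?F" "y \<in> ?F" for x y
    using that keys_add_subset by simp
  have "quotient_form n (coset_of n x) (coset_of n y \<otimes>\<^bsub>R n\<^esub> coset_of n z) =
      quotient_form n (coset_of n x) (coset_of n y) + quotient_form n (coset_of n x) (coset_of n z)"
    "quotient_form n (coset_of n y \<otimes>\<^bsub>R n\<^esub> coset_of n z) (coset_of n x) =
      quotient_form n (coset_of n y) (coset_of n x) + quotient_form n (coset_of n z) (coset_of n x)"
    if "x \<in> ?F" "y \<in> ?F" "z \<in> ?F" for x y z
    unfolding coset_of_mult[OF that(2,3)]
    using that add_in[OF that(2,3)]
    by (simp_all add: quotient_form_coset_of form_add_left form_add_right
        del: carrier_free_Abelian_group_iff) (simp_all add: form_add_left form_add_right)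
  then show ?thesis
    unfolding bilinear_form_def hom_def carrier by (auto simp: integer_group_def)
qed

theorem proposition3p1p2:
  fixes n :: nat
  shows "(\<forall>l r. type_I n l r \<or> type_II n l r \<longrightarrow>
            (\<forall>y \<in> carrier (free_Abelian_group (diagrams n)).
               form n l y = form n r y \<and> form n y l = form n y r))
       \<and> (\<exists>B. bilinear_form (R n) B \<and>
            (\<forall>x \<in> carrier (free_Abelian_group (diagrams n)).
             \<forall>y \<in> carrier (free_Abelian_group (diagrams n)).
               B (coset_of n x) (coset_of n y) = form n x y))"
proof (intro conjI allI impI ballI exI[of _ "quotient_form n"])
  fix l r y
  assume lr: "type_I n l r \<or> type_II n l r"
    and y: "y \<in> carrier (free_Abelian_group (diagrams n))"
  \<comment> \<open>Equality of all weights suffices for both arguments, since the form is a sum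
    over states of products of weights.\<close>
  have w: "state_weight l S = state_weight r S" for S
    using lr type_I_state_weight type_II_state_weight by blast
  show "form n l y = form n r y" "form n y l = form n y r"
    using y relation_carrier[OF lr] by (simp_all add: form_eq_states w)
qed (use bilinear_quotient_form quotient_form_coset_of in blast)+

end
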